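(* Let $G$ be a finite set of finite sets with $n$ elements, with constant energy $h(x)=1$ for all $x\in G$, and let $\Gamma^{++}$ and $\Gamma^{--}$ be the multigraphs with vertex set $G$ and adjacency matrices $L^{++}$ and $L^{--}$. Then $\Gamma^{++}$ and $\Gamma^{--}$ have the same spectral zeta function and the same Ihara zeta function.
   Context: For $x\in G$ let $W^+(x)=\{y\in G: x\subset y\}$ and $W^-(x)=\{y\in G: y\subset x\}$ (both include $x$). For $A\subset G$ put $E[A]=\sum_{x\in A}h(x)$, which for $h=1$ is the cardinality of $A$. The matrices, indexed by $G\times G$, are $L^{--}(x,y)=E[W^-(x)\cap W^-(y)]$ and $L^{++}(x,y)=E[W^+(x)\cap W^+(y)]$. The multigraph $\Gamma^{--}$ (respectively $\Gamma^{++}$) has the elements of $G$ as nodes and exactly $L^{--}(x,y)$ (respectively $L^{++}(x,y)$) connections from $x$ to $y$. For a multigraph with positive definite $n\times n$ adjacency matrix $A$ with eigenvalues $\lambda_1,\dots,\lambda_n>0$, the spectral zeta function is $\zeta(s)=\sum_{k=1}^n\lambda_k^{-s}$, $s\in\mathbb{C}$, where $\lambda_k^{-s}=e^{-s\log\lambda_k}$, and the Ihara zeta function is, in the paper's convention, $\zeta_I(s)=1/\det(1-sA)$. For $h=1$ both $L^{--}$ and $L^{++}$ are positive definite. No closure property of $G$ under subsets is assumed. *)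

theory Defs
  imports
    "HOL-Analysis.Analysis"
    "Jordan_Normal_Form.Spectral_Radius"
    "Graph_Theory.Digraph"
begin

section \<open>Connection matrices of a finite set of sets\<close>

definition W_plus :: "'a set set \<Rightarrow> 'a set \<Rightarrow> 'a set set" where
  "W_plus G x = {y \<in> G. x \<subseteq> y}"

definition W_minus :: "'a set set \<Rightarrow> 'a set \<Rightarrow> 'a set set" where
  "W_minus G x = {y \<in> G. y \<subseteq> x}"

definition energy :: "('a set \<Rightarrow> 'b::comm_monoid_add) \<Rightarrow> 'a set set \<Rightarrow> 'b" where
  "energy h A = (\<Sum>x\<in>A. h x)"

definition L_plus_plus ::
  "('a set \<Rightarrow> 'b::comm_monoid_add) \<Rightarrow> 'a set set \<Rightarrow> 'a set \<Rightarrow> 'a set \<Rightarrow> 'b" where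
  "L_plus_plus h G x y = energy h (W_plus G x \<inter> W_plus G y)"

definition L_minus_minus ::
  "('a set \<Rightarrow> 'b::comm_monoid_add) \<Rightarrow> 'a set set \<Rightarrow> 'a set \<Rightarrow> 'a set \<Rightarrow> 'b" where
  "L_minus_minus h G x y = energy h (W_minus G x \<inter> W_minus G y)"


section \<open>Multigraphs with prescribed numbers of connections\<close>

text \<open>
  The arcs from x to y are the triples (x, y, k) with k < m x y, so that there are
  exactly m x y of them; loops are allowed.
\<close>

definition multigraph ::
  "'v set \<Rightarrow> ('v \<Rightarrow> 'v \<Rightarrow> nat) \<Rightarrow> ('v, 'v \<times> 'v \<times> nat) pre_digraph" where
  "multigraph V m =
     \<lparr> verts = V,
       arcs = {(x, y, k). x \<in> V \<and> y \<in> V \<and> k < m x y},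
       tail = (\<lambda>(x, y, k). x),
       head = (\<lambda>(x, y, k). y) \<rparr>"

text \<open>Numbers of connections are natural numbers, hence so are the energies from here on.\<close>

definition Gamma_plus_plus ::
  "('a set \<Rightarrow> nat) \<Rightarrow> 'a set set \<Rightarrow> ('a set, 'a set \<times> 'a set \<times> nat) pre_digraph" where
  "Gamma_plus_plus h G = multigraph G (L_plus_plus h G)"

definition Gamma_minus_minus ::
  "('a set \<Rightarrow> nat) \<Rightarrow> 'a set set \<Rightarrow> ('a set, 'a set \<times> 'a set \<times> nat) pre_digraph" where
  "Gamma_minus_minus h G = multigraph G (L_minus_minus h G)"


section \<open>Adjacency matrices and zeta functions of a multigraph\<close>

definition num_arcs :: "('v, 'e) pre_digraph \<Rightarrow> 'v \<Rightarrow> 'v \<Rightarrow> nat" where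
  "num_arcs \<Gamma> x y = card {e \<in> arcs \<Gamma>. tail \<Gamma> e = x \<and> head \<Gamma> e = y}"

text \<open>The adjacency matrix with respect to an enumeration of the vertices.\<close>

definition adjacency_mat_wrt :: "'v list \<Rightarrow> ('v, 'e) pre_digraph \<Rightarrow> complex mat" where
  "adjacency_mat_wrt vs \<Gamma> =
     mat (length vs) (length vs) (\<lambda>(i, j). of_nat (num_arcs \<Gamma> (vs ! i) (vs ! j)))"

text \<open>
  Matrices of type \<^typ>\<open>complex mat\<close> are indexed by initial segments of the natural numbers,
  so an enumeration of the vertices is chosen. All choices give similar matrices, and hence the
  same zeta functions; see \<open>similar_adjacency_mat\<close>, \<open>spectral_zeta_eq\<close> and \<open>ihara_zeta_eq\<close> below.
\<close>

definition adjacency_mat :: "('v, 'e) pre_digraph \<Rightarrow> complex mat" where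
  "adjacency_mat \<Gamma> = adjacency_mat_wrt (SOME vs. distinct vs \<and> set vs = verts \<Gamma>) \<Gamma>"

text \<open>
  Eigenvalues are summed with algebraic multiplicity. \<^const>\<open>ln\<close> is the principal branch
  of the logarithm, which is the real logarithm on the eigenvalues of a positive definite matrix.
\<close>

definition mat_spectral_zeta :: "complex mat \<Rightarrow> complex \<Rightarrow> complex" where
  "mat_spectral_zeta A s =
     (\<Sum>l\<in>spectrum A. of_nat (order l (char_poly A)) * exp (- s * ln l))"

definition mat_ihara_zeta :: "complex mat \<Rightarrow> complex \<Rightarrow> complex" where
  "mat_ihara_zeta A s = 1 / det (1\<^sub>m (dim_row A) - s \<cdot>\<^sub>m A)"

definition spectral_zeta :: "('v, 'e) pre_digraph \<Rightarrow> complex \<Rightarrow> complex" where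
  "spectral_zeta \<Gamma> = mat_spectral_zeta (adjacency_mat \<Gamma>)"

text \<open>
  At a pole the value is 0 (division by zero), which is attained nowhere else. So equality
  of two such functions includes equality of their sets of poles.
\<close>

definition ihara_zeta :: "('v, 'e) pre_digraph \<Rightarrow> complex \<Rightarrow> complex" where
  "ihara_zeta \<Gamma> = mat_ihara_zeta (adjacency_mat \<Gamma>)"


section \<open>Consistency of the definitions\<close>

lemma num_arcs_multigraph:
  assumes "x \<in> V" "y \<in> V"
  shows "num_arcs (multigraph V m) x y = m x y"
proof -
  have "{e \<in> arcs (multigraph V m). tail (multigraph V m) e = x \<and> head (multigraph V m) e = y}
        = (\<lambda>k. (x, y, k)) ` {..<m x y}"
    using assms by (auto simp: multigraph_def)
  then show ?thesis
    by (simp add: num_arcs_def card_image inj_on_def)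
qed

lemma similar_adjacency_mat:
  assumes vs: "distinct vs" and ws: "distinct ws" and eq: "set vs = set ws"
  shows "similar_mat (adjacency_mat_wrt vs \<Gamma>) (adjacency_mat_wrt ws \<Gamma>)"
proof -
  define n where "n = length vs"
  have n: "length ws = n"
    using vs ws eq unfolding n_def by (metis distinct_card)
  define P :: "'a list \<Rightarrow> 'a list \<Rightarrow> complex mat" where
    "P us us' = mat n n (\<lambda>(i, j). if us ! i = us' ! j then 1 else 0)" for us us'
  have sum_nth: "(\<Sum>k = 0..<n. f (us ! k)) = (\<Sum>u\<in>set us. f u)"
    if "distinct us" "length us = n" for us and f :: "'a \<Rightarrow> complex"
    using that by (simp add: sum.distinct_set_conv_list sum_list_sum_nth)
  have PP: "P us us' * P us' us = 1\<^sub>m n"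
    if "distinct us" "length us = n" "distinct us'" "length us' = n" "set us = set us'" for us us'
  proof (rule eq_matI)
    fix i j assume "i < dim_row (1\<^sub>m n :: complex mat)" "j < dim_col (1\<^sub>m n :: complex mat)"
    then have ij: "i < n" "j < n" by auto
    have "(P us us' * P us' us) $$ (i, j) =
        (\<Sum>k = 0..<n. (\<lambda>u. (if us ! i = u then 1 else 0) * (if u = us ! j then 1 else 0)) (us' ! k))"
      using ij by (simp add: P_def scalar_prod_def)
    also have "\<dots> = (\<Sum>u\<in>set us'. (if us ! i = u then 1 else 0) * (if u = us ! j then 1 else 0))"
      by (rule sum_nth[OF that(3,4)])
    also have "\<dots> = (\<Sum>u\<in>set us'. if u = us ! i then (if u = us ! j then 1 else 0) else 0)"
      by (rule sum.cong) auto
    also have "\<dots> = 1\<^sub>m n $$ (i, j)"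
      using that ij by (auto simp: sum.delta nth_eq_iff_index_eq dest: nth_mem)
    finally show "(P us us' * P us' us) $$ (i, j) = 1\<^sub>m n $$ (i, j)" .
  qed (auto simp: P_def)
  have carr: "adjacency_mat_wrt vs \<Gamma> \<in> carrier_mat n n" "adjacency_mat_wrt ws \<Gamma> \<in> carrier_mat n n"
    "P vs ws \<in> carrier_mat n n" "P ws vs \<in> carrier_mat n n"
    by (auto simp: adjacency_mat_wrt_def P_def n n_def)
  have PA: "P vs ws * adjacency_mat_wrt ws \<Gamma> =
      mat n n (\<lambda>(i, j). of_nat (num_arcs \<Gamma> (vs ! i) (ws ! j)))" (is "_ = ?M")
  proof (rule eq_matI)
    fix i j assume "i < dim_row ?M" "j < dim_col ?M"
    then have ij: "i < n" "j < n" by auto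
    have "(P vs ws * adjacency_mat_wrt ws \<Gamma>) $$ (i, j) =
        (\<Sum>k = 0..<n. (\<lambda>u. (if vs ! i = u then 1 else 0) * of_nat (num_arcs \<Gamma> u (ws ! j))) (ws ! k))"
      using ij by (simp add: P_def adjacency_mat_wrt_def scalar_prod_def n)
    also have "\<dots> = (\<Sum>u\<in>set ws. (if vs ! i = u then 1 else 0) * of_nat (num_arcs \<Gamma> u (ws ! j)))"
      by (rule sum_nth[OF ws n])
    also have "\<dots> = (\<Sum>u\<in>set ws. if u = vs ! i then of_nat (num_arcs \<Gamma> u (ws ! j)) else 0)"
      by (rule sum.cong) auto
    also have "\<dots> = of_nat (num_arcs \<Gamma> (vs ! i) (ws ! j))"
      using ij eq nth_mem[of i vs] by (simp add: sum.delta n_def)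
    finally show "(P vs ws * adjacency_mat_wrt ws \<Gamma>) $$ (i, j) = ?M $$ (i, j)"
      using ij by simp
  qed (auto simp: P_def adjacency_mat_wrt_def n)
  have PAP: "adjacency_mat_wrt vs \<Gamma> = ?M * P ws vs" (is "?A = _")
  proof (rule eq_matI)
    fix i j assume "i < dim_row (?M * P ws vs)" "j < dim_col (?M * P ws vs)"
    then have ij: "i < n" "j < n" by (auto simp: P_def)
    have "(?M * P ws vs) $$ (i, j) =
        (\<Sum>k = 0..<n. (\<lambda>u. of_nat (num_arcs \<Gamma> (vs ! i) u) * (if u = vs ! j then 1 else 0)) (ws ! k))"
      using ij by (simp add: P_def scalar_prod_def)
    also have "\<dots> = (\<Sum>u\<in>set ws. of_nat (num_arcs \<Gamma> (vs ! i) u) * (if u = vs ! j then 1 else 0))"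
      by (rule sum_nth[OF ws n])
    also have "\<dots> = (\<Sum>u\<in>set ws. if u = vs ! j then of_nat (num_arcs \<Gamma> (vs ! i) u) else 0)"
      by (rule sum.cong) auto
    also have "\<dots> = of_nat (num_arcs \<Gamma> (vs ! i) (vs ! j))"
      using ij eq nth_mem[of j vs] by (simp add: sum.delta n_def)
    finally show "?A $$ (i, j) = (?M * P ws vs) $$ (i, j)"
      using ij by (simp add: adjacency_mat_wrt_def n_def)
  qed (auto simp: P_def adjacency_mat_wrt_def n_def)
  have A: "?A = P vs ws * adjacency_mat_wrt ws \<Gamma> * P ws vs"
    unfolding PA by (rule PAP)
  have PP': "P vs ws * P ws vs = 1\<^sub>m n" "P ws vs * P vs ws = 1\<^sub>m n"
    by (rule PP; use vs ws n eq n_def in simp)+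
  show ?thesis
    by (rule similar_matI[OF _ PP' A]) (use carr in simp)
qed

lemma mat_spectral_zeta_similar:
  assumes "similar_mat A B"
  shows "mat_spectral_zeta A = mat_spectral_zeta B"
proof -
  obtain n where "A \<in> carrier_mat n n" "B \<in> carrier_mat n n"
    using similar_matD[OF assms] by blast
  then show ?thesis
    by (simp add: fun_eq_iff mat_spectral_zeta_def spectrum_root_char_poly char_poly_similar[OF assms])
qed

lemma mat_ihara_zeta_similar:
  assumes "similar_mat A B"
  shows "mat_ihara_zeta A = mat_ihara_zeta B"
proof
  fix s
  obtain n P Q where c: "A \<in> carrier_mat n n" "B \<in> carrier_mat n n"
      "P \<in> carrier_mat n n" "Q \<in> carrier_mat n n"
    and PQ: "P * Q = 1\<^sub>m n" "Q * P = 1\<^sub>m n" and A: "A = P * B * Q"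
    using similar_matD[OF assms] by (metis insert_subset)
  have "P * (1\<^sub>m n - s \<cdot>\<^sub>m B) * Q = (P - s \<cdot>\<^sub>m (P * B)) * Q"
    using c by (simp add: mult_minus_distrib_mat[of P n n _ n] mult_smult_distrib[of P n n B n])
  also have "\<dots> = 1\<^sub>m n - s \<cdot>\<^sub>m A"
    using c PQ(1) by (subst minus_mult_distrib_mat[of P n n _ Q n]; simp add: A[symmetric] mult_smult_assoc_mat[of "P * B" n n Q n])
  finally have eq: "1\<^sub>m n - s \<cdot>\<^sub>m A = P * (1\<^sub>m n - s \<cdot>\<^sub>m B) * Q" by simp
  have "similar_mat (1\<^sub>m n - s \<cdot>\<^sub>m A) (1\<^sub>m n - s \<cdot>\<^sub>m B)"
    by (rule similar_matI[OF _ PQ eq]) (use c in auto)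
  from det_similar[OF this] show "mat_ihara_zeta A s = mat_ihara_zeta B s"
    using c by (simp add: mat_ihara_zeta_def)
qed

lemma similar_adjacency_mat_wrt:
  assumes "distinct vs" "set vs = verts \<Gamma>"
  shows "similar_mat (adjacency_mat \<Gamma>) (adjacency_mat_wrt vs \<Gamma>)"
proof -
  have "distinct (SOME vs. distinct vs \<and> set vs = verts \<Gamma>) \<and>
        set (SOME vs. distinct vs \<and> set vs = verts \<Gamma>) = verts \<Gamma>"
    by (rule someI_ex) (use assms in blast)
  then show ?thesis
    using assms unfolding adjacency_mat_def by (intro similar_adjacency_mat) auto
qed

lemma spectral_zeta_eq:
  assumes "distinct vs" "set vs = verts \<Gamma>"
  shows "spectral_zeta \<Gamma> = mat_spectral_zeta (adjacency_mat_wrt vs \<Gamma>)"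
  unfolding spectral_zeta_def
  by (rule mat_spectral_zeta_similar[OF similar_adjacency_mat_wrt[OF assms]])

lemma ihara_zeta_eq:
  assumes "distinct vs" "set vs = verts \<Gamma>"
  shows "ihara_zeta \<Gamma> = mat_ihara_zeta (adjacency_mat_wrt vs \<Gamma>)"
  unfolding ihara_zeta_def
  by (rule mat_ihara_zeta_similar[OF similar_adjacency_mat_wrt[OF assms]])

end

theory Submission
  imports Defs
begin

text \<open>
  For \<open>h = 1\<close> let \<open>Z\<close> be the incidence matrix of inclusion, \<open>Z(x, y) = 1\<close> if \<open>x \<subseteq> y\<close> and
  \<open>0\<close> otherwise. Counting the common supersets of \<open>x\<close> and \<open>y\<close> is a sum over the middle index of a
  matrix product, so \<open>L\<^sup>+\<^sup>+ = Z Z\<^sup>T\<close>; counting the common subsets likewise gives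
  \<open>L\<^sup>-\<^sup>- = Z\<^sup>T Z\<close>. Listing the finite sets by nondecreasing cardinality makes \<open>Z\<close> upper triangular with
  ones on the diagonal, so \<open>Z\<close> is invertible and
  \<open>Z Z\<^sup>T = Z (Z\<^sup>T Z) Z\<^sup>-\<^sup>1\<close>: the two adjacency matrices are similar. Both zeta
  functions are similarity invariants.
\<close>

definition inclusion_mat :: "'a set list \<Rightarrow> complex mat" where
  "inclusion_mat vs =
     mat (length vs) (length vs) (\<lambda>(i, j). if vs ! i \<subseteq> vs ! j then 1 else 0)"

lemma inclusion_mat_carrier [simp]:
  "inclusion_mat vs \<in> carrier_mat (length vs) (length vs)"
  by (simp add: inclusion_mat_def)

text \<open>
  A nonzero entry below the diagonal would be an inclusion of a finite set in one listed earlier,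
  hence of no larger cardinality; the two sets would then be equal. So the matrix is unitriangular.
\<close>

lemma det_inclusion_mat:
  assumes "distinct vs" and "sorted (map card vs)" and "\<And>x. x \<in> set vs \<Longrightarrow> finite x"
  shows "det (inclusion_mat vs) = 1"
proof -
  have "upper_triangular (inclusion_mat vs)"
  proof (rule upper_triangularI)
    fix i j assume "j < i" "i < dim_row (inclusion_mat vs)"
    then have ij: "j < i" "i < length vs" "j < length vs" by (auto simp: inclusion_mat_def)
    have "card (vs ! j) \<le> card (vs ! i)"
      using sorted_nth_mono[OF assms(2), of j i] ij by simp
    moreover have "vs ! j \<noteq> vs ! i"
      using assms(1) ij by (simp add: nth_eq_iff_index_eq)
    ultimately have "\<not> vs ! i \<subseteq> vs ! j"
      using assms(3) card_seteq[of "vs ! j" "vs ! i"] ij by auto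
    then show "inclusion_mat vs $$ (i, j) = 0"
      using ij by (simp add: inclusion_mat_def)
  qed
  moreover have "diag_mat (inclusion_mat vs) = replicate (length vs) 1"
    by (rule nth_equalityI) (auto simp: diag_mat_def inclusion_mat_def)
  ultimately show ?thesis
    by (simp add: det_upper_triangular[OF _ inclusion_mat_carrier])
qed

text \<open>
  The conjugating matrix is \<open>A\<close> itself: \<open>A (B A) A\<^sup>-\<^sup>1 = A B\<close>.
\<close>

lemma similar_mat_mult_commute:
  fixes A B :: "'b::field mat"
  assumes A: "A \<in> carrier_mat n n" and B: "B \<in> carrier_mat n n" and "det A \<noteq> 0"
  shows "similar_mat (A * B) (B * A)"
proof -
  \<comment> \<open>The ring of matrices carries an arbitrary extra record field, instantiated by \<open>undefined\<close>.\<close>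
  obtain C where C: "C \<in> carrier_mat n n" "A * C = 1\<^sub>m n" "C * A = 1\<^sub>m n"
    using det_non_zero_imp_unit[OF A assms(3), of undefined]
    by (auto simp: Units_def ring_mat_def)
  have "A * (B * A) * C = A * B * (A * C)"
    using A B C(1) by (simp add: assoc_mult_mat[of _ n n _ n _ n])
  then have eq: "A * B = A * (B * A) * C"
    using A B C(2) by simp
  show ?thesis
    by (rule similar_matI[OF _ C(2,3) eq]) (use A B C(1) in auto)
qed

lemma sum_nth_indicator:
  assumes "distinct vs"
  shows "(\<Sum>k = 0..<length vs. if P (vs ! k) then 1 else 0) =
         (of_nat (card {z \<in> set vs. P z}) :: complex)"
proof -
  have "(\<Sum>k = 0..<length vs. if P (vs ! k) then 1 else 0) =
        (\<Sum>z\<in>set vs. if P z then 1 else (0::complex))"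
    using assms by (simp add: sum.distinct_set_conv_list sum_list_sum_nth)
  then show ?thesis
    by (simp add: sum.If_cases Int_def)
qed

text \<open>
  Row \<open>x\<close> of the inclusion matrix is the indicator vector of \<open>W\<^sup>+(x)\<close> and column \<open>x\<close> that of
  \<open>W\<^sup>-(x)\<close>. The inner product of two indicator vectors is the size of the intersection, so the
  row products give \<open>L\<^sup>+\<^sup>+\<close> here, and the column products give \<open>L\<^sup>-\<^sup>-\<close> in the next lemma.
\<close>

lemma adjacency_mat_Gamma_plus_plus:
  assumes "distinct vs" and "set vs = G" and h: "\<forall>x\<in>G. h x = 1"
  shows "adjacency_mat_wrt vs (Gamma_plus_plus h G) =
         inclusion_mat vs * transpose_mat (inclusion_mat vs)"
proof (rule eq_matI)
  fix i j
  assume "i < dim_row (inclusion_mat vs * transpose_mat (inclusion_mat vs))"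
    "j < dim_col (inclusion_mat vs * transpose_mat (inclusion_mat vs))"
  then have ij: "i < length vs" "j < length vs" by (auto simp: inclusion_mat_def)
  then have "vs ! i \<in> G" "vs ! j \<in> G" using assms(2) by auto
  then have "adjacency_mat_wrt vs (Gamma_plus_plus h G) $$ (i, j) =
      of_nat (L_plus_plus h G (vs ! i) (vs ! j))"
    using ij by (simp add: adjacency_mat_wrt_def Gamma_plus_plus_def num_arcs_multigraph)
  also have "L_plus_plus h G (vs ! i) (vs ! j) = card {z \<in> set vs. vs ! i \<subseteq> z \<and> vs ! j \<subseteq> z}"
  proof -
    have "W_plus G (vs ! i) \<inter> W_plus G (vs ! j) = {z \<in> set vs. vs ! i \<subseteq> z \<and> vs ! j \<subseteq> z}"
      using assms(2) by (auto simp: W_plus_def)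
    then show ?thesis
      using h assms(2) by (simp add: L_plus_plus_def energy_def)
  qed
  also have "of_nat \<dots> = (\<Sum>k = 0..<length vs. if vs ! i \<subseteq> vs ! k \<and> vs ! j \<subseteq> vs ! k then 1 else (0::complex))"
    by (rule sum_nth_indicator[OF assms(1), symmetric])
  also have "\<dots> = (inclusion_mat vs * transpose_mat (inclusion_mat vs)) $$ (i, j)"
    using ij by (auto simp: inclusion_mat_def scalar_prod_def intro!: sum.cong)
  finally show "adjacency_mat_wrt vs (Gamma_plus_plus h G) $$ (i, j) =
      (inclusion_mat vs * transpose_mat (inclusion_mat vs)) $$ (i, j)" .
qed (auto simp: adjacency_mat_wrt_def inclusion_mat_def)

lemma adjacency_mat_Gamma_minus_minus:
  assumes "distinct vs" and "set vs = G" and h: "\<forall>x\<in>G. h x = 1"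
  shows "adjacency_mat_wrt vs (Gamma_minus_minus h G) =
         transpose_mat (inclusion_mat vs) * inclusion_mat vs"
proof (rule eq_matI)
  fix i j
  assume "i < dim_row (transpose_mat (inclusion_mat vs) * inclusion_mat vs)"
    "j < dim_col (transpose_mat (inclusion_mat vs) * inclusion_mat vs)"
  then have ij: "i < length vs" "j < length vs" by (auto simp: inclusion_mat_def)
  then have "vs ! i \<in> G" "vs ! j \<in> G" using assms(2) by auto
  then have "adjacency_mat_wrt vs (Gamma_minus_minus h G) $$ (i, j) =
      of_nat (L_minus_minus h G (vs ! i) (vs ! j))"
    using ij by (simp add: adjacency_mat_wrt_def Gamma_minus_minus_def num_arcs_multigraph)
  also have "L_minus_minus h G (vs ! i) (vs ! j) = card {z \<in> set vs. z \<subseteq> vs ! i \<and> z \<subseteq> vs ! j}"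
  proof -
    have "W_minus G (vs ! i) \<inter> W_minus G (vs ! j) = {z \<in> set vs. z \<subseteq> vs ! i \<and> z \<subseteq> vs ! j}"
      using assms(2) by (auto simp: W_minus_def)
    then show ?thesis
      using h assms(2) by (simp add: L_minus_minus_def energy_def)
  qed
  also have "of_nat \<dots> = (\<Sum>k = 0..<length vs. if vs ! k \<subseteq> vs ! i \<and> vs ! k \<subseteq> vs ! j then 1 else (0::complex))"
    by (rule sum_nth_indicator[OF assms(1), symmetric])
  also have "\<dots> = (transpose_mat (inclusion_mat vs) * inclusion_mat vs) $$ (i, j)"
    using ij by (auto simp: inclusion_mat_def scalar_prod_def intro!: sum.cong)
  finally show "adjacency_mat_wrt vs (Gamma_minus_minus h G) $$ (i, j) =
      (transpose_mat (inclusion_mat vs) * inclusion_mat vs) $$ (i, j)" .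
qed (auto simp: adjacency_mat_wrt_def inclusion_mat_def)

theorem corollary6:
  fixes G :: "'a set set" and n :: nat and h :: "'a set \<Rightarrow> nat"
  assumes "finite G" and "\<forall>x\<in>G. finite x" and "card G = n"
    and "\<forall>x\<in>G. h x = 1"
  shows "spectral_zeta (Gamma_plus_plus h G) = spectral_zeta (Gamma_minus_minus h G) \<and>
         ihara_zeta (Gamma_plus_plus h G) = ihara_zeta (Gamma_minus_minus h G)"
proof -
  obtain us where us: "set us = G" "distinct us"
    using finite_distinct_list[OF assms(1)] by blast
  define vs where "vs = sort_key card us"
  have vs: "distinct vs" "set vs = G" "sorted (map card vs)"
    using us by (auto simp: vs_def)
  have "det (inclusion_mat vs) = 1"
    using det_inclusion_mat vs assms(2) by blast
  then have "similar_mat (adjacency_mat_wrt vs (Gamma_plus_plus h G))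
                         (adjacency_mat_wrt vs (Gamma_minus_minus h G))"
    unfolding adjacency_mat_Gamma_plus_plus[OF vs(1,2) assms(4)]
      adjacency_mat_Gamma_minus_minus[OF vs(1,2) assms(4)]
    by (intro similar_mat_mult_commute[of _ "length vs"]) auto
  note sim = mat_spectral_zeta_similar[OF this] mat_ihara_zeta_similar[OF this]
  have verts: "set vs = verts (Gamma_plus_plus h G)" "set vs = verts (Gamma_minus_minus h G)"
    using vs(2) by (simp_all add: Gamma_plus_plus_def Gamma_minus_minus_def multigraph_def)
  show ?thesis
    using sim by (simp add: spectral_zeta_eq[OF vs(1) verts(1)] spectral_zeta_eq[OF vs(1) verts(2)]
        ihara_zeta_eq[OF vs(1) verts(1)] ihara_zeta_eq[OF vs(1) verts(2)])
qed

end
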